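(* Let $U,V\subseteq\mathbb{R}^n$ be linear subspaces with $V\not\subset U$ and let $T=P_VP_U$. For every $v\in V$, $$A_T(v)=B_T(v)=C_T(v).$$ Moreover, when $T(v)\neq v$, the common value is $$A_T(v)=B_T(v)=C_T(v)=v+\mu_v\bigl(T(v)-v\bigr),\qquad \mu_v=\frac{\operatorname{dist}^2(v,U)}{\|T(v)-v\|^2}.$$
   Context: For a linear subspace $W\subseteq\mathbb{R}^n$, $P_W$ is the orthogonal projection onto $W$, $R_W=2P_W-\mathrm{Id}$, and $\operatorname{dist}(x,W)=\|x-P_Wx\|$. For $x\in\mathbb{R}^n$ define $$A_T(x)=(1-\lambda_x)x+\lambda_xP_VP_Ux,\quad \lambda_x=\frac{\langle x-P_VP_Ux,\,x\rangle}{\|x-P_VP_Ux\|^2},$$ $$B_T(x)=(1-\mu^{\mathrm B}_x)P_Vx+\mu^{\mathrm B}_xP_VP_Ux,\quad \mu^{\mathrm B}_x=\frac{\langle P_Vx-P_VP_Ux,\,x\rangle}{\|P_Vx-P_VP_Ux\|^2},$$ with the convention $\lambda_x=1$, respectively $\mu^{\mathrm B}_x=1$, when the respective denominator vanishes. Circumcenter: for a finite set $S\subset\mathbb{R}^n$ for which some point $q\in\mathbb{R}^n$ is equidistant from all elements of $S$, $\mathrm{circumcenter}(S):=P_{\mathrm{aff}(S)}(q)$, the orthogonal projection of $q$ onto the affine hull of $S$ (independent of the choice of $q$). The circumcentered--reflection operator is $C_T(x):=\mathrm{circumcenter}\{x,R_Ux,R_VR_Ux\}$ (any point of $U\cap V$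 is equidistant from the three vertices). *)

theory Defs
  imports "HOL-Analysis.Analysis"
begin

(* For affine S the vectors y - p (y in S) range over the direction space of S, so this
   covers linear subspaces as well as affine hulls.  Existence and uniqueness of p:
   orth_proj_char below. *)
definition orth_proj :: "'a::euclidean_space set \<Rightarrow> 'a \<Rightarrow> 'a" where
  "orth_proj S x = (THE p. p \<in> S \<and> (\<forall>y\<in>S. orthogonal (x - p) (y - p)))"

definition reflector :: "'a::euclidean_space set \<Rightarrow> 'a \<Rightarrow> 'a" where
  "reflector W x = 2 *\<^sub>R orth_proj W x - x"

(* Agrees with infdist x W, see dist_to_eq_infdist. *)
definition dist_to :: "'a::euclidean_space \<Rightarrow> 'a set \<Rightarrow> real" where
  "dist_to x W = norm (x - orth_proj W x)"

definition equidistant_from :: "'a::euclidean_space \<Rightarrow> 'a set \<Rightarrow> bool" where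
  "equidistant_from q S \<longleftrightarrow> (\<exists>r. \<forall>s\<in>S. dist q s = r)"

(* Meaningful only if S is nonempty and has an equidistant point; it does not depend on the
   one chosen, see circumcenter_eq. *)
definition circumcenter :: "'a::euclidean_space set \<Rightarrow> 'a" where
  "circumcenter S = orth_proj (affine hull S) (SOME q. equidistant_from q S)"

definition T_op :: "'a::euclidean_space set \<Rightarrow> 'a set \<Rightarrow> 'a \<Rightarrow> 'a" where
  "T_op U V x = orth_proj V (orth_proj U x)"

definition lambda_A :: "'a::euclidean_space set \<Rightarrow> 'a set \<Rightarrow> 'a \<Rightarrow> real" where
  "lambda_A U V x =
     (if (norm (x - T_op U V x))\<^sup>2 = 0 then 1
      else ((x - T_op U V x) \<bullet> x) / (norm (x - T_op U V x))\<^sup>2)"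

definition A_op :: "'a::euclidean_space set \<Rightarrow> 'a set \<Rightarrow> 'a \<Rightarrow> 'a" where
  "A_op U V x = (1 - lambda_A U V x) *\<^sub>R x + lambda_A U V x *\<^sub>R T_op U V x"

definition mu_B :: "'a::euclidean_space set \<Rightarrow> 'a set \<Rightarrow> 'a \<Rightarrow> real" where
  "mu_B U V x =
     (if (norm (orth_proj V x - T_op U V x))\<^sup>2 = 0 then 1
      else ((orth_proj V x - T_op U V x) \<bullet> x) / (norm (orth_proj V x - T_op U V x))\<^sup>2)"

definition B_op :: "'a::euclidean_space set \<Rightarrow> 'a set \<Rightarrow> 'a \<Rightarrow> 'a" where
  "B_op U V x = (1 - mu_B U V x) *\<^sub>R orth_proj V x + mu_B U V x *\<^sub>R T_op U V x"

definition C_op :: "'a::euclidean_space set \<Rightarrow> 'a set \<Rightarrow> 'a \<Rightarrow> 'a" where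
  "C_op U V x = circumcenter {x, reflector U x, reflector V (reflector U x)}"

lemma orth_proj_unique:
  assumes "p \<in> S" "\<forall>y\<in>S. orthogonal (x - p) (y - p)"
    and "q \<in> S" "\<forall>y\<in>S. orthogonal (x - q) (y - q)"
  shows "p = q"
proof -
  have "(x - p) \<bullet> (q - p) = 0" "(x - q) \<bullet> (p - q) = 0"
    using assms by (auto simp: orthogonal_def)
  then have "(p - q) \<bullet> (p - q) = 0"
    by (simp add: inner_diff_left inner_diff_right inner_commute)
  then show ?thesis by simp
qed

lemma affine_imp_closed:
  fixes S :: "'a::euclidean_space set"
  shows "affine S \<Longrightarrow> closed S"
  by (metis affine_hull_eq closed_affine_hull)

lemma closest_point_affine_orthogonal:
  fixes S :: "'a::euclidean_space set"
  assumes "affine S" "S \<noteq> {}" "y \<in> S"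
  shows "orthogonal (x - closest_point S x) (y - closest_point S x)"
proof -
  let ?p = "closest_point S x"
  have p: "?p \<in> S"
    by (simp add: assms affine_imp_closed closest_point_in_set)
  have "2 *\<^sub>R ?p + (-1) *\<^sub>R y \<in> S"
    by (intro mem_affine assms p) simp
  then have z: "2 *\<^sub>R ?p - y \<in> S" by simp
  have "(x - ?p) \<bullet> (y - ?p) \<le> 0"
    by (simp add: assms affine_imp_convex affine_imp_closed closest_point_dot)
  moreover have "(x - ?p) \<bullet> ((2 *\<^sub>R ?p - y) - ?p) \<le> 0"
    using z by (simp add: assms affine_imp_convex affine_imp_closed closest_point_dot)
  ultimately show ?thesis
    by (simp add: orthogonal_def inner_diff_left inner_diff_right algebra_simps)
qed

lemma orth_proj_eq_closest_point:
  fixes S :: "'a::euclidean_space set"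
  assumes "affine S" "S \<noteq> {}"
  shows "orth_proj S x = closest_point S x"
proof -
  have p: "closest_point S x \<in> S"
    by (simp add: assms affine_imp_closed closest_point_in_set)
  show ?thesis
    unfolding orth_proj_def
  proof (rule the_equality)
    show c: "closest_point S x \<in> S \<and>
        (\<forall>y\<in>S. orthogonal (x - closest_point S x) (y - closest_point S x))"
      using p closest_point_affine_orthogonal[OF assms] by simp
    show "q = closest_point S x" if "q \<in> S \<and> (\<forall>y\<in>S. orthogonal (x - q) (y - q))" for q
      by (rule orth_proj_unique[of q S x]) (use that c in simp_all)
  qed
qed

lemma orth_proj_char:
  fixes S :: "'a::euclidean_space set"
  assumes "affine S" "S \<noteq> {}"
  shows "orth_proj S x = p \<longleftrightarrow> p \<in> S \<and> (\<forall>y\<in>S. orthogonal (x - p) (y - p))"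
proof -
  let ?c = "closest_point S x"
  have c: "?c \<in> S" "\<forall>y\<in>S. orthogonal (x - ?c) (y - ?c)"
    using assms closest_point_affine_orthogonal[OF assms]
    by (simp_all add: affine_imp_closed closest_point_in_set)
  show ?thesis
    unfolding orth_proj_eq_closest_point[OF assms]
    using c orth_proj_unique[of ?c S x p] by auto
qed

lemma dist_to_eq_infdist:
  assumes "subspace W"
  shows "dist_to x W = infdist x W"
proof -
  have W: "affine W" "W \<noteq> {}"
    using assms subspace_imp_affine subspace_0 by blast+
  then show ?thesis
    by (simp add: dist_to_def orth_proj_eq_closest_point infdist_eq_setdist
        setdist_closest_point affine_imp_closed dist_norm)
qed

lemma circumcenter_eq:
  assumes S: "S \<noteq> {}" and q: "equidistant_from q S"
  shows "circumcenter S = orth_proj (affine hull S) q"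
proof -
  define q' where "q' = (SOME q. equidistant_from q S)"
  have q': "equidistant_from q' S"
    unfolding q'_def using q by (rule someI)
  define A where "A = affine hull S"
  obtain s where s: "s \<in> S" using S by blast
  have A: "affine A" "A \<noteq> {}" using S by (auto simp: A_def)
  have "(q' - q) \<bullet> t = (q' - q) \<bullet> s" if t: "t \<in> S" for t
  proof -
    have "dist q t = dist q s" "dist q' t = dist q' s"
      using q q' s t by (auto simp: equidistant_from_def)
    then have "(q - t) \<bullet> (q - t) = (q - s) \<bullet> (q - s)"
      "(q' - t) \<bullet> (q' - t) = (q' - s) \<bullet> (q' - s)"
      by (simp_all add: dist_norm norm_eq)
    then show ?thesis
      by (simp add: inner_diff_left inner_diff_right inner_commute)
  qed
  then have "S \<subseteq> {t. (q' - q) \<bullet> t = (q' - q) \<bullet> s}" by blast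
  then have "A \<subseteq> {t. (q' - q) \<bullet> t = (q' - q) \<bullet> s}"
    unfolding A_def by (intro hull_minimal affine_hyperplane)
  then have const: "(q' - q) \<bullet> t = (q' - q) \<bullet> s" if "t \<in> A" for t
    using that by blast
  define p where "p = orth_proj A q"
  have p: "p \<in> A" "\<forall>y\<in>A. orthogonal (q - p) (y - p)"
    using orth_proj_char[OF A] p_def by blast+
  have "orthogonal (q' - p) (y - p)" if y: "y \<in> A" for y
  proof -
    have "(q - p) \<bullet> (y - p) = 0" using p y by (auto simp: orthogonal_def)
    moreover have "(q' - q) \<bullet> (y - p) = 0"
      using const[OF y] const[OF p(1)] by (simp add: inner_diff_right)
    ultimately show ?thesis
      by (simp add: orthogonal_def inner_diff_left)
  qed
  then have "orth_proj A q' = p"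
    using orth_proj_char[OF A] p(1) by blast
  then show ?thesis
    by (simp add: circumcenter_def q'_def A_def p_def)
qed

end

theory Submission
  imports Defs
begin

text \<open>
  Fix \<open>v \<in> V\<close> and write \<open>u = P\<^sub>U v\<close>, \<open>t = P\<^sub>V u = T v\<close>. Since \<open>P\<^sub>V v = v\<close>, the formulas
  for \<open>A\<^sub>T v\<close> and \<open>B\<^sub>T v\<close> coincide literally. As \<open>v - u\<close> is orthogonal to \<open>u\<close> and \<open>u - t\<close> is
  orthogonal to \<open>v\<close>,
  \<open>dist\<^sup>2(v, U) = \<langle>v - u, v\<rangle> = \<langle>v - t, v\<rangle>\<close>,
  so the step length \<open>\<lambda>\<^sub>v\<close> is the one claimed (\<open>dist_to_squared_eq_inner\<close>). The same identity shows
  that \<open>T v = v\<close> forces \<open>u = v\<close>; then both reflections fix \<open>v\<close> and all three operators return \<open>v\<close>.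

  Suppose \<open>t \<noteq> v\<close>. Reflections are isometries fixing \<open>0\<close>, so \<open>0\<close> is equidistant from the three
  vertices and \<open>C\<^sub>T v\<close> is the point of their affine hull closest to \<open>0\<close>. The vertices are \<open>v\<close>,
  \<open>y = v + 2(u - v)\<close> and \<open>z = v + 4(t - v) - 2(u - v)\<close>, so the affine hull is
  \<open>v + span {u - v, t - v}\<close> and contains the whole line through \<open>v\<close> and \<open>t\<close>. The point \<open>w\<close> of that
  line with step \<open>\<lambda>\<^sub>v\<close> is orthogonal to \<open>t - v\<close>, by the choice of \<open>\<lambda>\<^sub>v\<close>. It lies in \<open>V\<close>, and
  \<open>u - t\<close> is orthogonal to \<open>V\<close>, so it is orthogonal to \<open>u - v\<close> as well. Hence \<open>w\<close> is the required
  projection of \<open>0\<close> (\<open>C_op_eq\<close>).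
\<close>

lemma orth_proj_subspace_char:
  assumes "subspace W"
  shows "orth_proj W x = p \<longleftrightarrow> p \<in> W \<and> (\<forall>y\<in>W. (x - p) \<bullet> y = 0)"
proof -
  have W: "affine W" "W \<noteq> {}"
    using assms subspace_imp_affine subspace_0 by blast+
  have "(\<forall>y\<in>W. (x - p) \<bullet> (y - p) = 0) \<longleftrightarrow> (\<forall>y\<in>W. (x - p) \<bullet> y = 0)" if "p \<in> W"
  proof
    assume orth: "\<forall>y\<in>W. (x - p) \<bullet> (y - p) = 0"
    show "\<forall>y\<in>W. (x - p) \<bullet> y = 0"
    proof
      fix y assume "y \<in> W"
      then have "y + p \<in> W" using assms that subspace_add by blast
      then show "(x - p) \<bullet> y = 0" using orth by force
    qed
  next
    assume "\<forall>y\<in>W. (x - p) \<bullet> y = 0"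
    then show "\<forall>y\<in>W. (x - p) \<bullet> (y - p) = 0"
      using assms that subspace_diff by blast
  qed
  then show ?thesis
    unfolding orth_proj_char[OF W] orthogonal_def by blast
qed

lemma orth_proj_subspace_mem:
  "subspace W \<Longrightarrow> orth_proj W x \<in> W"
  using orth_proj_subspace_char by blast

lemma orth_proj_residual_orthogonal:
  "subspace W \<Longrightarrow> y \<in> W \<Longrightarrow> (x - orth_proj W x) \<bullet> y = 0"
  using orth_proj_subspace_char by blast

lemma orth_proj_fixes:
  "subspace W \<Longrightarrow> x \<in> W \<Longrightarrow> orth_proj W x = x"
  by (simp add: orth_proj_subspace_char)

lemma norm_reflector:
  assumes "subspace W"
  shows "norm (reflector W x) = norm x"
proof -
  have "(x - orth_proj W x) \<bullet> orth_proj W x = 0"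
    using assms by (intro orth_proj_residual_orthogonal orth_proj_subspace_mem)
  then show ?thesis
    unfolding norm_eq reflector_def
    by (simp add: inner_diff_left inner_diff_right inner_commute)
qed

lemma orth_proj_V_reflector_U:
  assumes V: "subspace V" and v: "v \<in> V"
  shows "orth_proj V (reflector U v) = 2 *\<^sub>R T_op U V v - v"
  unfolding orth_proj_subspace_char[OF V]
proof
  show "2 *\<^sub>R T_op U V v - v \<in> V"
    unfolding T_op_def
    by (intro subspace_diff subspace_scale orth_proj_subspace_mem V v)
  have "reflector U v - (2 *\<^sub>R T_op U V v - v)
      = 2 *\<^sub>R (orth_proj U v - orth_proj V (orth_proj U v))"
    by (simp add: reflector_def T_op_def scaleR_diff_right)
  then show "\<forall>y\<in>V. (reflector U v - (2 *\<^sub>R T_op U V v - v)) \<bullet> y = 0"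
    using orth_proj_residual_orthogonal[OF V] by simp
qed

text \<open>
  Both equalities in the chain \<open>\<parallel>v - u\<parallel>\<^sup>2 = \<langle>v - u, v\<rangle> = \<langle>v - T v, v\<rangle>\<close>, with \<open>u = P\<^sub>U v\<close>, come from an
  orthogonality: \<open>v - u \<bottom> u\<close> for the first, \<open>u - T v \<bottom> v\<close> for the second.
\<close>

lemma dist_to_squared_eq_inner:
  assumes U: "subspace U" and V: "subspace V" and v: "v \<in> V"
  shows "(dist_to v U)\<^sup>2 = (v - T_op U V v) \<bullet> v"
proof -
  define u where "u = orth_proj U v"
  have "(v - u) \<bullet> u = 0"
    unfolding u_def using U by (intro orth_proj_residual_orthogonal orth_proj_subspace_mem)
  moreover have "(u - T_op U V v) \<bullet> v = 0"
    unfolding T_op_def u_def using V v by (rule orth_proj_residual_orthogonal)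
  ultimately show ?thesis
    unfolding dist_to_def u_def[symmetric] power2_norm_eq_inner
    by (simp add: inner_diff_left inner_diff_right inner_commute)
qed

lemma orth_proj_eq_if_T_op_fixed:
  assumes "subspace U" "subspace V" "v \<in> V" and "T_op U V v = v"
  shows "orth_proj U v = v"
  using dist_to_squared_eq_inner[OF assms(1-3)] assms(4) by (simp add: dist_to_def)

lemma B_op_eq_A_op:
  assumes "subspace V" "v \<in> V"
  shows "B_op U V v = A_op U V v"
  using assms by (simp add: A_op_def B_op_def lambda_A_def mu_B_def orth_proj_fixes)

lemma A_op_eq:
  assumes "subspace U" "subspace V" "v \<in> V" and "T_op U V v \<noteq> v"
  shows "A_op U V v
    = v + ((dist_to v U)\<^sup>2 / (norm (T_op U V v - v))\<^sup>2) *\<^sub>R (T_op U V v - v)"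
proof -
  have "lambda_A U V v = (dist_to v U)\<^sup>2 / (norm (T_op U V v - v))\<^sup>2"
    using assms by (simp add: lambda_A_def dist_to_squared_eq_inner norm_minus_commute)
  then show ?thesis
    by (simp add: A_op_def algebra_simps)
qed

lemma A_op_fixed: "T_op U V v = v \<Longrightarrow> A_op U V v = v"
  by (simp add: A_op_def algebra_simps)

text \<open>
  The choice \<open>q = 0 \<in> U \<inter> V\<close> reduces the circumcenter to the foot of a perpendicular from the origin.
\<close>

lemma C_op_eq_orth_proj_zero:
  assumes "subspace U" "subspace V"
  shows "C_op U V x
    = orth_proj (affine hull {x, reflector U x, reflector V (reflector U x)}) 0"
  unfolding C_op_def
  by (rule circumcenter_eq) (use assms in \<open>auto simp: equidistant_from_def norm_reflector\<close>)

lemma C_op_fixed: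
  assumes U: "subspace U" and V: "subspace V" and v: "v \<in> V" and fixed: "T_op U V v = v"
  shows "C_op U V v = v"
proof -
  have "reflector U v = v"
    by (simp add: reflector_def orth_proj_eq_if_T_op_fixed[OF assms] scaleR_2)
  moreover have "reflector V v = v"
    by (simp add: reflector_def orth_proj_fixes[OF V v] scaleR_2)
  ultimately show ?thesis
    by (simp add: C_op_eq_orth_proj_zero[OF U V] orth_proj_char orthogonal_clauses)
qed

text \<open>
  The candidate \<open>w\<close> is the foot of the perpendicular from \<open>0\<close> to the line through \<open>v\<close> and \<open>T v\<close>.
  Both \<open>v\<close> and \<open>T v\<close> lie in \<open>V\<close>, hence so does \<open>w\<close>, and this makes it the foot of the perpendicular to
  the generally two-dimensional hull of the three vertices too: that hull lies in the hyperplane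
  through \<open>v\<close> with normal \<open>w\<close>.
\<close>

lemma C_op_eq:
  assumes U: "subspace U" and V: "subspace V" and v: "v \<in> V" and moved: "T_op U V v \<noteq> v"
  shows "C_op U V v
    = v + ((dist_to v U)\<^sup>2 / (norm (T_op U V v - v))\<^sup>2) *\<^sub>R (T_op U V v - v)"
proof -
  define u where "u = orth_proj U v"
  define t where "t = T_op U V v"
  define \<mu> where "\<mu> = (dist_to v U)\<^sup>2 / (norm (t - v))\<^sup>2"
  define w where "w = v + \<mu> *\<^sub>R (t - v)"
  define y where "y = reflector U v"
  define z where "z = reflector V y"
  define H where "H = affine hull {v, y, z}"
  have y: "y = v + 2 *\<^sub>R (u - v)"
    by (simp add: y_def reflector_def u_def algebra_simps scaleR_2)
  have "z = 2 *\<^sub>R (2 *\<^sub>R t - v) - y"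
    unfolding z_def reflector_def[of V] y_def t_def orth_proj_V_reflector_U[OF V v] ..
  then have z: "z = v + 4 *\<^sub>R (t - v) - 2 *\<^sub>R (u - v)"
    using scaleR_add_left[of 2 2 v] by (simp add: y algebra_simps scaleR_2[of v])
  have tV: "t \<in> V"
    unfolding t_def T_op_def by (rule orth_proj_subspace_mem[OF V])
  then have wV: "w \<in> V"
    unfolding w_def by (intro subspace_add subspace_scale subspace_diff V v)

  have "\<mu> * ((t - v) \<bullet> (t - v)) = (v - t) \<bullet> v"
    using moved dist_to_squared_eq_inner[OF U V v]
    by (simp add: \<mu>_def t_def power2_norm_eq_inner)
  then have w_orth_t: "w \<bullet> (t - v) = 0"
    unfolding w_def inner_add_left inner_scaleR_left
    by (simp add: inner_diff_left inner_diff_right inner_commute)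
  have "(u - t) \<bullet> w = 0"
    unfolding u_def t_def T_op_def using V wV by (rule orth_proj_residual_orthogonal)
  with w_orth_t have w_orth_u: "w \<bullet> (u - v) = 0"
    by (simp add: inner_diff_left inner_diff_right inner_commute)

  have "{v, y, z} \<subseteq> {p. w \<bullet> p = w \<bullet> v}"
    using w_orth_t w_orth_u by (simp add: y z inner_add_right inner_diff_right)
  then have hyperplane: "H \<subseteq> {p. w \<bullet> p = w \<bullet> v}"
    unfolding H_def by (intro hull_minimal affine_hyperplane)

  \<comment> \<open>The components along \<open>u - v\<close> cancel in \<open>y + z\<close>, leaving \<open>(y - v) + (z - v) = 4 (t - v)\<close>.\<close>
  have "w = (1 - \<mu> / 2) *\<^sub>R v + (\<mu> / 4) *\<^sub>R y + (\<mu> / 4) *\<^sub>R z"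
  proof -
    have "(\<mu> / 4) *\<^sub>R y + (\<mu> / 4) *\<^sub>R z = (\<mu> / 4) *\<^sub>R (y + z)"
      by (simp add: scaleR_add_right)
    also have "y + z = 2 *\<^sub>R v + 4 *\<^sub>R (t - v)"
      by (simp add: y z scaleR_2[of v])
    finally show ?thesis
      by (simp add: w_def algebra_simps)
  qed
  moreover have "(1 - \<mu> / 2) + \<mu> / 4 + \<mu> / 4 = 1"
    by simp
  ultimately have wH: "w \<in> H"
    unfolding H_def affine_hull_3 by blast

  have "orthogonal (0 - w) (p - w)" if "p \<in> H" for p
  proof -
    have "w \<bullet> p = w \<bullet> v" "w \<bullet> w = w \<bullet> v"
      using hyperplane that wH by blast+
    then show ?thesis
      by (simp add: orthogonal_def inner_diff_right)
  qed
  then have "orth_proj H 0 = w"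
    using wH orth_proj_char[of H 0 w] by (auto simp: H_def)
  then show ?thesis
    by (simp add: C_op_eq_orth_proj_zero[OF U V] H_def y_def z_def w_def \<mu>_def t_def)
qed

theorem theorem3p7:
  fixes U V :: "(real ^ 'n) set"
  assumes "subspace U" and "subspace V" and "\<not> V \<subseteq> U"
  shows "\<forall>v\<in>V.
      A_op U V v = B_op U V v \<and> B_op U V v = C_op U V v \<and>
      (T_op U V v \<noteq> v \<longrightarrow>
        (let \<mu> = (dist_to v U)\<^sup>2 / (norm (T_op U V v - v))\<^sup>2;
             w = v + \<mu> *\<^sub>R (T_op U V v - v)
         in A_op U V v = w \<and> B_op U V v = w \<and> C_op U V v = w))"
proof
  fix v assume v: "v \<in> V"
  note UV = assms(1,2) v
  show "A_op U V v = B_op U V v \<and> B_op U V v = C_op U V v \<and>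
      (T_op U V v \<noteq> v \<longrightarrow>
        (let \<mu> = (dist_to v U)\<^sup>2 / (norm (T_op U V v - v))\<^sup>2;
             w = v + \<mu> *\<^sub>R (T_op U V v - v)
         in A_op U V v = w \<and> B_op U V v = w \<and> C_op U V v = w))"
  proof (cases "T_op U V v = v")
    case True
    then show ?thesis
      by (simp add: B_op_eq_A_op[OF UV(2,3)] A_op_fixed C_op_fixed[OF UV])
  next
    case False
    then show ?thesis
      by (simp add: B_op_eq_A_op[OF UV(2,3)] A_op_eq[OF UV] C_op_eq[OF UV] Let_def)
  qed
qed

end
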